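(* Let $\beta\in(0,1)$ and $\alpha\in[-\beta,\beta]$. Let $\{m_n:n\in\mathbb{N}\}$ be a sequence of positive integers with $1\le m_n\le n$ for each $n\in\mathbb{N}$, $\lim_{n\to\infty}m_n=+\infty$, and, with $\gamma_n:=m_n/n$, $\lim_{n\to\infty}\gamma_n=\gamma\in[0,1]$. Consider the elephant random walk with stops in the triangular array setting with parameters $\alpha,\beta$ and increments $Y^{(n)}_k$ (defined in the context), and let $\Xi_n:=\sum_{k=1}^n\{Y^{(n)}_k\}^2$ for $n\in\mathbb{N}$. Then $$\lim_{n\to\infty}\frac{\gamma_n\Xi_n}{(m_n)^{\beta}}=\{\gamma+\beta(1-\gamma)\}\Sigma\quad\text{in }L^2,$$ where $\Sigma$ is the random variable such that $\Sigma_n/n^{\beta}\to\Sigma$ a.s. and in $L^2$.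
   Context: Elephant random walk with stops. Let $s\in[0,1]$, $p,q\in[0,1)$, $r\in(0,1)$ with $p+q+r=1$, and put $\alpha:=p-q$, $\beta:=1-r$, so $\beta\in(0,1)$, $\alpha\in[-\beta,\beta]$. Let $X_1=+1$ with probability $s$ and $X_1=-1$ with probability $1-s$. Let $\{U_n:n\ge1\}$ be independent random variables, independent of $X_1$, with $U_n$ uniform on $\{1,\dots,n\}$, and for $n\in\mathbb{N}=\{1,2,\dots\}$ let $X_{n+1}=X_{U_n}$ with probability $p$, $X_{n+1}=-X_{U_n}$ with probability $q$, and $X_{n+1}=0$ with probability $r$ (these choices being independent of each other and of everything else). Put $\Sigma_n=\sum_{k=1}^n1_{\{X_k\ne0\}}=\sum_{k=1}^nX_k^2$. It is known that $\Sigma_n/n^\beta$ converges a.s. and in $L^2$ to a random variable $\Sigma>0$, which has a Mittag-Leffler distribution with parameter $\beta$. Triangular array setting. Given $\{m_n\}$ with $1\le m_n\le n$, for each $n$ and $1\le k\le n$ let $Y^{(n)}_k=X_k$ for $1\le k\le m_n$ and $Y^{(n)}_k=X^{(n)}_k$ for $m_n<k\le n$, where for $m_n<k\le n$, $X^{(n)}_k=X_{U_{k,n}}$ with probability $p$, $X^{(n)}_k=-X_{U_{k,n}}$ with probability $q$, and $X^{(n)}_k=0$ with probability $r$. Here $\mathcal{U}_n=\{U_{k,n}:m_n<k\le n\}$ is an i.i.d. collection of uniform random variables on $\{1,\dots,m_n\}$, and the collections $\mathcal{U}_n$, $n\in\mathbb{N}$, are independent (of each other and of $\{X_i\}$); the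 choices with probabilities $p,q,r$ are again independent of each other and of everything else. *)

theory Defs
  imports "HOL-Probability.Probability"
begin

(* Squared-mean convergence; the limit and every member of the sequence are required to be
   in L^2, so the Bochner integrals below are never the default value 0. *)
definition tendsto_L2 :: "'a measure \<Rightarrow> (nat \<Rightarrow> 'a \<Rightarrow> real) \<Rightarrow> ('a \<Rightarrow> real) \<Rightarrow> bool" where
  "tendsto_L2 M f g \<longleftrightarrow>
     (\<forall>n. f n \<in> borel_measurable M \<and> integrable M (\<lambda>\<omega>. (f n \<omega>)\<^sup>2)) \<and>
     g \<in> borel_measurable M \<and> integrable M (\<lambda>\<omega>. (g \<omega>)\<^sup>2) \<and>
     (\<lambda>n. \<integral>\<omega>. (f n \<omega> - g \<omega>)\<^sup>2 \<partial>M) \<longlonglongrightarrow> 0"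

(* Names for the elementary random variables driving the model. The last two constructors
   take the row n first and the position k within the row second. *)
datatype source =
    Init
  | Mem nat
  | Choice nat
  | Row_Mem nat nat
  | Row_Choice nat nat

definition sources :: "(nat \<Rightarrow> nat) \<Rightarrow> source set" where
  "sources m = {Init} \<union> {Mem n | n. 1 \<le> n} \<union> {Choice n | n. 1 \<le> n}
     \<union> {Row_Mem n k | n k. 1 \<le> n \<and> m n < k \<and> k \<le> n}
     \<union> {Row_Choice n k | n k. 1 \<le> n \<and> m n < k \<and> k \<le> n}"

(* The three-way choice "repeat / reverse / stop" is a sign taking the values 1, -1, 0 with
   probabilities p, q, r, by which the recalled step is multiplied: C n is the choice made
   for X (n+1), and D n k the one made for position k > m n of row n. Likewise U n is the
   recalled time for X (n+1), and V n k the one for position k of row n. *)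
locale erw_stops_array = prob_space M
  for M :: "'a measure" +
  fixes s p q r :: real
    and m :: "nat \<Rightarrow> nat"
    and X :: "nat \<Rightarrow> 'a \<Rightarrow> real"
    and U :: "nat \<Rightarrow> 'a \<Rightarrow> nat"
    and C :: "nat \<Rightarrow> 'a \<Rightarrow> real"
    and V :: "nat \<Rightarrow> nat \<Rightarrow> 'a \<Rightarrow> nat"
    and D :: "nat \<Rightarrow> nat \<Rightarrow> 'a \<Rightarrow> real"
  assumes s: "0 \<le> s" "s \<le> 1"
    and p: "0 \<le> p" "p < 1"
    and q: "0 \<le> q" "q < 1"
    and r: "0 < r" "r < 1"
    and pqr: "p + q + r = 1"
    and m: "\<And>n. 1 \<le> n \<Longrightarrow> 1 \<le> m n \<and> m n \<le> n"
    and X_init: "\<P>(\<omega> in M. X 1 \<omega> = 1) = s" "\<P>(\<omega> in M. X 1 \<omega> = -1) = 1 - s"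
    and U_range: "\<And>n \<omega>. 1 \<le> n \<Longrightarrow> \<omega> \<in> space M \<Longrightarrow> U n \<omega> \<in> {1..n}"
    and U_unif: "\<And>n i. 1 \<le> n \<Longrightarrow> i \<in> {1..n} \<Longrightarrow> \<P>(\<omega> in M. U n \<omega> = i) = 1 / real n"
    and C_distr: "\<And>n. 1 \<le> n \<Longrightarrow> \<P>(\<omega> in M. C n \<omega> = 1) = p"
      "\<And>n. 1 \<le> n \<Longrightarrow> \<P>(\<omega> in M. C n \<omega> = -1) = q"
      "\<And>n. 1 \<le> n \<Longrightarrow> \<P>(\<omega> in M. C n \<omega> = 0) = r"
    and X_step: "\<And>n \<omega>. 1 \<le> n \<Longrightarrow> \<omega> \<in> space M \<Longrightarrow> X (Suc n) \<omega> = C n \<omega> * X (U n \<omega>) \<omega>"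
    and V_range: "\<And>n k \<omega>. 1 \<le> n \<Longrightarrow> m n < k \<Longrightarrow> k \<le> n \<Longrightarrow> \<omega> \<in> space M \<Longrightarrow> V n k \<omega> \<in> {1..m n}"
    and V_unif: "\<And>n k i. 1 \<le> n \<Longrightarrow> m n < k \<Longrightarrow> k \<le> n \<Longrightarrow> i \<in> {1..m n} \<Longrightarrow>
      \<P>(\<omega> in M. V n k \<omega> = i) = 1 / real (m n)"
    and D_distr: "\<And>n k. 1 \<le> n \<Longrightarrow> m n < k \<Longrightarrow> k \<le> n \<Longrightarrow> \<P>(\<omega> in M. D n k \<omega> = 1) = p"
      "\<And>n k. 1 \<le> n \<Longrightarrow> m n < k \<Longrightarrow> k \<le> n \<Longrightarrow> \<P>(\<omega> in M. D n k \<omega> = -1) = q"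
      "\<And>n k. 1 \<le> n \<Longrightarrow> m n < k \<Longrightarrow> k \<le> n \<Longrightarrow> \<P>(\<omega> in M. D n k \<omega> = 0) = r"
    and indep: "indep_vars (\<lambda>_. borel)
      (\<lambda>j. case j of
          Init \<Rightarrow> X 1
        | Mem n \<Rightarrow> (\<lambda>\<omega>. real (U n \<omega>))
        | Choice n \<Rightarrow> C n
        | Row_Mem n k \<Rightarrow> (\<lambda>\<omega>. real (V n k \<omega>))
        | Row_Choice n k \<Rightarrow> D n k)
      (sources m)"

definition moves :: "(nat \<Rightarrow> 'a \<Rightarrow> real) \<Rightarrow> nat \<Rightarrow> 'a \<Rightarrow> real" where
  "moves X n \<omega> = (\<Sum>k=1..n. of_bool (X k \<omega> \<noteq> 0))"

definition row_step :: "(nat \<Rightarrow> nat) \<Rightarrow> (nat \<Rightarrow> 'a \<Rightarrow> real) \<Rightarrow> (nat \<Rightarrow> nat \<Rightarrow> 'a \<Rightarrow> nat) \<Rightarrow>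
    (nat \<Rightarrow> nat \<Rightarrow> 'a \<Rightarrow> real) \<Rightarrow> nat \<Rightarrow> nat \<Rightarrow> 'a \<Rightarrow> real" where
  "row_step m X V D n k \<omega> = (if k \<le> m n then X k \<omega> else D n k \<omega> * X (V n k \<omega>) \<omega>)"

definition row_moves :: "(nat \<Rightarrow> nat) \<Rightarrow> (nat \<Rightarrow> 'a \<Rightarrow> real) \<Rightarrow> (nat \<Rightarrow> nat \<Rightarrow> 'a \<Rightarrow> nat) \<Rightarrow>
    (nat \<Rightarrow> nat \<Rightarrow> 'a \<Rightarrow> real) \<Rightarrow> nat \<Rightarrow> 'a \<Rightarrow> real" where
  "row_moves m X V D n \<omega> = (\<Sum>k=1..n. (row_step m X V D n k \<omega>)\<^sup>2)"

end

theory Submission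
  imports Defs
begin

text \<open>
  Write \<open>\<beta> = 1 - r\<close>, \<open>\<gamma>\<^sub>n = m n / n\<close> and let \<open>W = \<Sigma>\<^sub>m / m\<close> (writing \<open>m\<close> for \<open>m n\<close>) be the proportion of nonzero steps in
  the memory that row \<open>n\<close> recalls. Given that memory, each position \<open>k\<close> with \<open>m < k \<le> n\<close> moves with
  probability \<open>\<beta> W\<close>, independently of the other positions. The row therefore splits into its
  conditional mean and a fluctuation:
  \<open>\<Xi>\<^sub>n = \<Sigma>\<^sub>m + (n - m) \<beta> W + \<Sum>\<^sub>k (Z\<^sub>k - \<beta> W)\<close>, where \<open>Z\<^sub>k\<close> indicates a move at \<open>k\<close>.

  After multiplication by \<open>\<gamma>\<^sub>n / m powr \<beta>\<close> the conditional mean becomes exactly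
  \<open>(\<gamma>\<^sub>n + \<beta> (1 - \<gamma>\<^sub>n)) \<Sigma>\<^sub>m / m powr \<beta>\<close>, which has the asserted limit because \<open>m\<close> tends to infinity and
  \<open>\<Sigma>\<^sub>n / n powr \<beta>\<close> converges in squared mean. It remains to show that
  the fluctuation is negligible.

  Its terms, called innovations below, are pairwise orthogonal, and each has second moment at most
  \<open>2 E W\<close> (lemma \<open>expectation_sq_sum_innovations_le\<close>). The normalised fluctuation thus has second moment
  at most \<open>2 \<gamma>\<^sub>n m powr (-\<beta>) E (\<Sigma>\<^sub>m / m powr \<beta>)\<close>. Here the expectation is bounded, by the convergence in
  squared mean, and \<open>\<beta> > 0\<close> makes the bound vanish. Bounding \<open>W\<close> by 1 instead would only give
  \<open>m powr (2 - 2 \<beta>) / n\<close>, which need not vanish for \<open>\<beta> \<le> 1/2\<close>.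

  Orthogonality is obtained without conditional expectations. An innovation is a finite sum of
  products of \<open>(X i)\<^sup>2\<close> with centred variables that depend only on the two sources of position \<open>k\<close>, so it
  integrates to zero against every bounded function of the other sources
  (lemma \<open>expectation_mult_innovation\<close>).
\<close>

section \<open>Perturbation and scaling of convergence in squared mean\<close>

lemma integrable_sq_add:
  fixes f g :: "'a \<Rightarrow> real"
  assumes [measurable]: "f \<in> borel_measurable M" "g \<in> borel_measurable M"
    and "integrable M (\<lambda>\<omega>. (f \<omega>)\<^sup>2)" "integrable M (\<lambda>\<omega>. (g \<omega>)\<^sup>2)"
  shows "integrable M (\<lambda>\<omega>. (f \<omega> + g \<omega>)\<^sup>2)"
    and "(\<integral>\<omega>. (f \<omega> + g \<omega>)\<^sup>2 \<partial>M) \<le> 2 * (\<integral>\<omega>. (f \<omega>)\<^sup>2 \<partial>M) + 2 * (\<integral>\<omega>. (g \<omega>)\<^sup>2 \<partial>M)"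
proof -
  have *: "(a + b)\<^sup>2 \<le> 2 * a\<^sup>2 + 2 * b\<^sup>2" for a b :: real
    using sum_squares_bound[of a b] by (simp add: power2_sum)
  have B: "integrable M (\<lambda>\<omega>. 2 * (f \<omega>)\<^sup>2 + 2 * (g \<omega>)\<^sup>2)"
    using assms by simp
  show I: "integrable M (\<lambda>\<omega>. (f \<omega> + g \<omega>)\<^sup>2)"
    by (rule Bochner_Integration.integrable_bound[OF B]) (use * in auto)
  have "(\<integral>\<omega>. (f \<omega> + g \<omega>)\<^sup>2 \<partial>M) \<le> (\<integral>\<omega>. 2 * (f \<omega>)\<^sup>2 + 2 * (g \<omega>)\<^sup>2 \<partial>M)"
    using I B * by (intro integral_mono) auto
  also have "\<dots> = 2 * (\<integral>\<omega>. (f \<omega>)\<^sup>2 \<partial>M) + 2 * (\<integral>\<omega>. (g \<omega>)\<^sup>2 \<partial>M)"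
    using assms by simp
  finally show "(\<integral>\<omega>. (f \<omega> + g \<omega>)\<^sup>2 \<partial>M) \<le> 2 * (\<integral>\<omega>. (f \<omega>)\<^sup>2 \<partial>M) + 2 * (\<integral>\<omega>. (g \<omega>)\<^sup>2 \<partial>M)" .
qed

lemma integrable_sq_diff:
  fixes f g :: "'a \<Rightarrow> real"
  assumes [measurable]: "f \<in> borel_measurable M" "g \<in> borel_measurable M"
    and "integrable M (\<lambda>\<omega>. (f \<omega>)\<^sup>2)" "integrable M (\<lambda>\<omega>. (g \<omega>)\<^sup>2)"
  shows "integrable M (\<lambda>\<omega>. (f \<omega> - g \<omega>)\<^sup>2)"
  using integrable_sq_add(1)[of f M "\<lambda>\<omega>. - g \<omega>"] assms by simp

lemma tendsto_L2_perturb: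
  assumes fg: "tendsto_L2 M f g"
    and F: "\<And>n. F n \<in> borel_measurable M" "\<And>n. integrable M (\<lambda>\<omega>. (F n \<omega>)\<^sup>2)"
    and close: "(\<lambda>n. \<integral>\<omega>. (F n \<omega> - f n \<omega>)\<^sup>2 \<partial>M) \<longlonglongrightarrow> 0"
  shows "tendsto_L2 M F g"
proof -
  have f: "f n \<in> borel_measurable M" "integrable M (\<lambda>\<omega>. (f n \<omega>)\<^sup>2)" for n
    using fg by (auto simp: tendsto_L2_def)
  have g: "g \<in> borel_measurable M" "integrable M (\<lambda>\<omega>. (g \<omega>)\<^sup>2)"
    and lim: "(\<lambda>n. \<integral>\<omega>. (f n \<omega> - g \<omega>)\<^sup>2 \<partial>M) \<longlonglongrightarrow> 0"
    using fg by (auto simp: tendsto_L2_def)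
  have le: "(\<integral>\<omega>. (F n \<omega> - g \<omega>)\<^sup>2 \<partial>M) \<le>
      2 * (\<integral>\<omega>. (F n \<omega> - f n \<omega>)\<^sup>2 \<partial>M) + 2 * (\<integral>\<omega>. (f n \<omega> - g \<omega>)\<^sup>2 \<partial>M)" for n
    using integrable_sq_add(2)[of "\<lambda>\<omega>. F n \<omega> - f n \<omega>" M "\<lambda>\<omega>. f n \<omega> - g \<omega>"]
      integrable_sq_diff[OF F(1)[of n] f(1)[of n] F(2) f(2)]
      integrable_sq_diff[OF f(1)[of n] g(1) f(2) g(2)] F(1) f(1) g(1)
    by (auto intro: borel_measurable_diff)
  have "(\<lambda>n. \<integral>\<omega>. (F n \<omega> - g \<omega>)\<^sup>2 \<partial>M) \<longlonglongrightarrow> 0"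
  proof (rule tendsto_sandwich[OF _ _ tendsto_const])
    show "(\<lambda>n. 2 * (\<integral>\<omega>. (F n \<omega> - f n \<omega>)\<^sup>2 \<partial>M) + 2 * (\<integral>\<omega>. (f n \<omega> - g \<omega>)\<^sup>2 \<partial>M)) \<longlonglongrightarrow> 0"
      using tendsto_add[OF tendsto_mult_right_zero[OF close] tendsto_mult_right_zero[OF lim], of 2 2]
      by simp
  qed (use le in auto)
  then show ?thesis
    using F g by (auto simp: tendsto_L2_def)
qed

lemma tendsto_L2_reindex:
  assumes "tendsto_L2 M f g" and "filterlim \<phi> at_top sequentially"
  shows "tendsto_L2 M (\<lambda>n. f (\<phi> n)) g"
  using assms filterlim_compose[of "\<lambda>n. \<integral>\<omega>. (f n \<omega> - g \<omega>)\<^sup>2 \<partial>M" _ at_top \<phi>]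
  by (auto simp: tendsto_L2_def)

lemma tendsto_L2_scale:
  fixes c :: "nat \<Rightarrow> real"
  assumes fg: "tendsto_L2 M f g" and c: "c \<longlonglongrightarrow> c'"
  shows "tendsto_L2 M (\<lambda>n \<omega>. c n * f n \<omega>) (\<lambda>\<omega>. c' * g \<omega>)"
proof (rule tendsto_L2_perturb)
  have f: "f n \<in> borel_measurable M" "integrable M (\<lambda>\<omega>. (f n \<omega>)\<^sup>2)" for n
    using fg by (auto simp: tendsto_L2_def)
  have g: "g \<in> borel_measurable M" "integrable M (\<lambda>\<omega>. (g \<omega>)\<^sup>2)"
    and lim: "(\<lambda>n. \<integral>\<omega>. (f n \<omega> - g \<omega>)\<^sup>2 \<partial>M) \<longlonglongrightarrow> 0"
    using fg by (auto simp: tendsto_L2_def)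
  show "(\<lambda>\<omega>. c n * f n \<omega>) \<in> borel_measurable M" "integrable M (\<lambda>\<omega>. (c n * f n \<omega>)\<^sup>2)" for n
    using f[of n] by (auto simp: power_mult_distrib)
  show "tendsto_L2 M (\<lambda>n \<omega>. c n * g \<omega>) (\<lambda>\<omega>. c' * g \<omega>)"
  proof -
    have "(\<lambda>n. (c n - c')\<^sup>2 * (\<integral>\<omega>. (g \<omega>)\<^sup>2 \<partial>M)) \<longlonglongrightarrow> (c' - c')\<^sup>2 * (\<integral>\<omega>. (g \<omega>)\<^sup>2 \<partial>M)"
      by (intro tendsto_intros c)
    moreover have "(\<integral>\<omega>. (c n * g \<omega> - c' * g \<omega>)\<^sup>2 \<partial>M) = (c n - c')\<^sup>2 * (\<integral>\<omega>. (g \<omega>)\<^sup>2 \<partial>M)" for n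
      by (simp add: power_mult_distrib flip: left_diff_distrib)
    ultimately show ?thesis
      using g by (simp add: tendsto_L2_def power_mult_distrib)
  qed
  have "(\<lambda>n. (c n)\<^sup>2 * (\<integral>\<omega>. (f n \<omega> - g \<omega>)\<^sup>2 \<partial>M)) \<longlonglongrightarrow> c'\<^sup>2 * 0"
    by (intro tendsto_intros c lim)
  moreover have "(\<integral>\<omega>. (c n * f n \<omega> - c n * g \<omega>)\<^sup>2 \<partial>M) = (c n)\<^sup>2 * (\<integral>\<omega>. (f n \<omega> - g \<omega>)\<^sup>2 \<partial>M)" for n
    by (simp add: power_mult_distrib flip: right_diff_distrib)
  ultimately show "(\<lambda>n. \<integral>\<omega>. (c n * f n \<omega> - c n * g \<omega>)\<^sup>2 \<partial>M) \<longlonglongrightarrow> 0"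
    by simp
qed

text \<open>
  Since \<open>x \<le> 1 + x\<^sup>2\<close>, a bound on second moments suffices.
\<close>

lemma (in prob_space) tendsto_L2_expectation_bounded:
  assumes fg: "tendsto_L2 M f g"
  shows "\<exists>K. \<forall>n. expectation (f n) \<le> K"
proof -
  have f: "f n \<in> borel_measurable M" "integrable M (\<lambda>\<omega>. (f n \<omega>)\<^sup>2)" for n
    using fg by (auto simp: tendsto_L2_def)
  have g: "g \<in> borel_measurable M" "integrable M (\<lambda>\<omega>. (g \<omega>)\<^sup>2)"
    and lim: "(\<lambda>n. \<integral>\<omega>. (f n \<omega> - g \<omega>)\<^sup>2 \<partial>M) \<longlonglongrightarrow> 0"
    using fg by (auto simp: tendsto_L2_def)
  obtain B where B: "\<And>n. (\<integral>\<omega>. (f n \<omega> - g \<omega>)\<^sup>2 \<partial>M) \<le> B"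
    using convergent_imp_Bseq[OF convergentI[OF lim]] by (auto simp: Bseq_def abs_le_iff)
  have "expectation (f n) \<le> 1 + (2 * B + 2 * expectation (\<lambda>\<omega>. (g \<omega>)\<^sup>2))" for n
  proof -
    have "expectation (f n) \<le> expectation (\<lambda>\<omega>. 1 + (f n \<omega>)\<^sup>2)"
    proof (rule integral_mono)
      show "integrable M (f n)"
        using f[of n] square_integrable_imp_integrable by blast
      show "f n \<omega> \<le> 1 + (f n \<omega>)\<^sup>2" for \<omega>
      proof -
        have "2 * f n \<omega> \<le> (f n \<omega>)\<^sup>2 + 1"
          using sum_squares_bound[of "f n \<omega>" 1] by simp
        then show ?thesis
          using zero_le_power2[of "f n \<omega>"] by linarith
      qed
    qed (use f in simp)
    also have "\<dots> = 1 + expectation (\<lambda>\<omega>. (f n \<omega>)\<^sup>2)"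
      using f[of n] by (simp add: prob_space)
    also have "expectation (\<lambda>\<omega>. (f n \<omega>)\<^sup>2) \<le>
        2 * expectation (\<lambda>\<omega>. (f n \<omega> - g \<omega>)\<^sup>2) + 2 * expectation (\<lambda>\<omega>. (g \<omega>)\<^sup>2)"
      using integrable_sq_add(2)[of "\<lambda>\<omega>. f n \<omega> - g \<omega>" M g] f(1)[of n] g
        integrable_sq_diff[OF f(1)[of n] g(1) f(2) g(2)] by simp
    finally show ?thesis using B[of n] by linarith
  qed
  then show ?thesis by blast
qed

section \<open>Independence of functionals of disjoint sets of random sources\<close>

lemma sum_of_bool_eq_mult:
  fixes g :: "nat \<Rightarrow> real"
  assumes "a \<in> A" "finite A"
  shows "(\<Sum>i\<in>A. of_bool (a = i) * g i) = g a"
proof -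
  have "(\<Sum>i\<in>A. of_bool (a = i) * g i) = (\<Sum>i\<in>A. if a = i then g i else 0)"
    by (intro sum.cong) auto
  then show ?thesis using assms by simp
qed

context erw_stops_array
begin

definition driver :: "source \<Rightarrow> 'a \<Rightarrow> real" where
  "driver j = (case j of
      Init \<Rightarrow> X 1
    | Mem n \<Rightarrow> (\<lambda>\<omega>. real (U n \<omega>))
    | Choice n \<Rightarrow> C n
    | Row_Mem n k \<Rightarrow> (\<lambda>\<omega>. real (V n k \<omega>))
    | Row_Choice n k \<Rightarrow> D n k)"

text \<open>
  The variables \<open>X i\<close> are given by a recursion and not as explicit functions of the sources, so
  dependence on a set of sources is expressed as measurability with respect to the algebra that
  these sources generate.
\<close>

definition sigma_of :: "source set \<Rightarrow> 'a measure" where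
  "sigma_of J = vimage_algebra (space M) (\<lambda>\<omega>. \<lambda>j\<in>J. driver j \<omega>) (PiM J (\<lambda>_. borel))"

lemma space_sigma_of [simp]: "space (sigma_of J) = space M"
  by (simp add: sigma_of_def)

lemma indep_drivers: "indep_vars (\<lambda>_. borel) driver (sources m)"
  using indep unfolding driver_def[abs_def] .

lemma driver_measurable: "j \<in> sources m \<Longrightarrow> driver j \<in> borel_measurable M"
  using indep_drivers by (simp add: indep_vars_def)

lemma driver_measurable_sigma_of:
  assumes "j \<in> J"
  shows "driver j \<in> borel_measurable (sigma_of J)"
proof -
  have "(\<lambda>\<omega>. \<lambda>j\<in>J. driver j \<omega>) \<in> measurable (sigma_of J) (PiM J (\<lambda>_. borel))"
    unfolding sigma_of_def by (rule measurable_vimage_algebra1) (auto simp: space_PiM)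
  from measurable_compose[OF this measurable_component_singleton[OF assms]]
  show ?thesis using assms by simp
qed

lemma measurable_sigma_of_into:
  assumes "J \<subseteq> sources m" and f: "f \<in> measurable (sigma_of J) N"
  shows "f \<in> measurable M N"
proof -
  have "(\<lambda>\<omega>. \<omega>) \<in> measurable M (sigma_of J)"
    unfolding sigma_of_def
    by (intro measurable_vimage_algebra2 measurable_restrict driver_measurable)
       (use assms in auto)
  from measurable_compose[OF this f] show ?thesis .
qed

text \<open>
  This turns independence of the sources into independence of arbitrary functionals of two disjoint
  sets of sources, with no need to exhibit the functionals.
\<close>

lemma indep_sigma_of:
  assumes AB: "A \<inter> B = {}" "A \<subseteq> sources m" "B \<subseteq> sources m"
    and G: "G \<in> borel_measurable (sigma_of A)" and H: "H \<in> borel_measurable (sigma_of B)"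
  shows "indep_var borel (G :: 'a \<Rightarrow> real) borel (H :: 'a \<Rightarrow> real)"
proof -
  let ?T = "\<lambda>J \<omega>. \<lambda>j\<in>J. driver j \<omega>"
  have ind: "indep_var (PiM A (\<lambda>_. borel)) (?T A) (PiM B (\<lambda>_. borel)) (?T B)"
    by (rule indep_var_restrict[OF indep_drivers AB])
  have sub: "sigma_sets (space M) {F -` S \<inter> space M | S. S \<in> sets borel} \<subseteq>
      sigma_sets (space M) {?T J -` S \<inter> space M | S. S \<in> sets (PiM J (\<lambda>_. borel))}"
    if "F \<in> borel_measurable (sigma_of J)" for F :: "'a \<Rightarrow> real" and J
  proof (rule sigma_sets_mono)
    show "{F -` S \<inter> space M | S. S \<in> sets borel} \<subseteq>
      sigma_sets (space M) {?T J -` S \<inter> space M | S. S \<in> sets (PiM J (\<lambda>_. borel))}"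
      using measurable_sets[OF that] by (auto simp: sigma_of_def sets_vimage_algebra)
  qed
  have "indep_set (sigma_sets (space M) {G -` S \<inter> space M | S. S \<in> sets borel})
      (sigma_sets (space M) {H -` S \<inter> space M | S. S \<in> sets borel})"
    using ind unfolding indep_var_eq indep_set_def
    by (elim conjE, elim indep_sets_mono_sets) (use sub[OF G] sub[OF H] in \<open>auto split: bool.split\<close>)
  then show ?thesis
    using measurable_sigma_of_into[OF AB(2) G] measurable_sigma_of_into[OF AB(3) H]
    by (simp add: indep_var_eq)
qed

section \<open>The steps of the walk\<close>

text \<open>
  The recalled step \<open>X (U n)\<close> has a random index; it is a finite sum over the possible values of \<open>U n\<close>,
  and every \<open>X i\<close> in that sum has a smaller index.
\<close>

lemma X_measurable_wrt:
  assumes N: "space N = space M" "X 1 \<in> borel_measurable N"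
    "\<And>n. 1 \<le> n \<Longrightarrow> (\<lambda>\<omega>. real (U n \<omega>)) \<in> borel_measurable N"
    "\<And>n. 1 \<le> n \<Longrightarrow> C n \<in> borel_measurable N"
  shows "1 \<le> k \<Longrightarrow> X k \<in> borel_measurable N"
proof (induction k rule: less_induct)
  case (less k)
  show ?case
  proof (cases "k = 1")
    case False
    with less.prems obtain n where k: "k = Suc n" and n: "1 \<le> n"
      by (cases k) auto
    note [measurable] = N(3)[OF n] N(4)[OF n]
    have "(\<lambda>\<omega>. C n \<omega> * (\<Sum>i\<in>{1..n}. of_bool (real (U n \<omega>) = real i) * X i \<omega>)) \<in> borel_measurable N"
    proof (intro borel_measurable_times borel_measurable_sum)
      show "(\<lambda>\<omega>. of_bool (real (U n \<omega>) = real i) :: real) \<in> borel_measurable N" for i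
        by measurable
    qed (use less.IH k in auto)
    also have "?this \<longleftrightarrow> X k \<in> borel_measurable N"
    proof (rule measurable_cong)
      fix \<omega> assume "\<omega> \<in> space N"
      then have "U n \<omega> \<in> {1..n}" "X k \<omega> = C n \<omega> * X (U n \<omega>) \<omega>"
        using U_range X_step n N(1) k by auto
      then show "C n \<omega> * (\<Sum>i\<in>{1..n}. of_bool (real (U n \<omega>) = real i) * X i \<omega>) = X k \<omega>"
        using sum_of_bool_eq_mult[of "U n \<omega>" "{1..n}" "\<lambda>i. X i \<omega>"] by (simp only: of_nat_eq_iff) simp
    qed
    finally show ?thesis .
  qed (use N in simp)
qed

lemma walk_sources: "Init \<in> sources m" "1 \<le> n \<Longrightarrow> Mem n \<in> sources m" "1 \<le> n \<Longrightarrow> Choice n \<in> sources m"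
  by (auto simp: sources_def)

lemma row_sources:
  assumes "1 \<le> n" "m n < k" "k \<le> n"
  shows "Row_Mem n k \<in> sources m" "Row_Choice n k \<in> sources m"
  using assms by (auto simp: sources_def)

lemma X_measurable_sigma_of:
  assumes "{Init} \<union> {Mem n | n. 1 \<le> n} \<union> {Choice n | n. 1 \<le> n} \<subseteq> J" "1 \<le> k"
  shows "X k \<in> borel_measurable (sigma_of J)"
proof (rule X_measurable_wrt[OF _ _ _ _ \<open>1 \<le> k\<close>])
  show "X 1 \<in> borel_measurable (sigma_of J)"
    using driver_measurable_sigma_of[of Init J] assms(1) by (simp add: driver_def)
  show "(\<lambda>\<omega>. real (U n \<omega>)) \<in> borel_measurable (sigma_of J)" if "1 \<le> n" for n
    using driver_measurable_sigma_of[of "Mem n" J] assms(1) that by (auto simp: driver_def)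
  show "C n \<in> borel_measurable (sigma_of J)" if "1 \<le> n" for n
    using driver_measurable_sigma_of[of "Choice n" J] assms(1) that by (auto simp: driver_def)
qed simp

lemma X_measurable [measurable]:
  assumes "1 \<le> k"
  shows "X k \<in> borel_measurable M"
  by (rule measurable_sigma_of_into[OF order_refl X_measurable_sigma_of[OF _ assms]])
     (auto simp: sources_def)

lemma AE_signs:
  assumes [measurable]: "f \<in> borel_measurable M"
    and "\<P>(\<omega> in M. f \<omega> = 1) + \<P>(\<omega> in M. f \<omega> = -1) + \<P>(\<omega> in M. f \<omega> = (0::real)) = 1"
  shows "AE \<omega> in M. f \<omega> \<in> {-1, 0, 1}"
proof -
  have eq: "{\<omega>\<in>space M. f \<omega> = 1} \<union> {\<omega>\<in>space M. f \<omega> = -1} \<union> {\<omega>\<in>space M. f \<omega> = 0} =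
      {\<omega>\<in>space M. f \<omega> \<in> {-1, 0, 1}}"
    by auto
  have "prob ({\<omega>\<in>space M. f \<omega> = 1} \<union> {\<omega>\<in>space M. f \<omega> = -1} \<union> {\<omega>\<in>space M. f \<omega> = 0}) =
      prob ({\<omega>\<in>space M. f \<omega> = 1} \<union> {\<omega>\<in>space M. f \<omega> = -1}) + prob {\<omega>\<in>space M. f \<omega> = 0}"
    by (rule finite_measure_Union) auto
  also have "prob ({\<omega>\<in>space M. f \<omega> = 1} \<union> {\<omega>\<in>space M. f \<omega> = -1}) =
      prob {\<omega>\<in>space M. f \<omega> = 1} + prob {\<omega>\<in>space M. f \<omega> = -1}"
    by (rule finite_measure_Union) auto
  finally have "prob {\<omega>\<in>space M. f \<omega> \<in> {-1, 0, 1}} = 1"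
    using assms(2) eq by simp
  from AE_prob_1[OF this] show ?thesis by auto
qed

text \<open>
  The model fixes only probabilities that add up to 1, so the sources, and with them all steps, take
  values in \<open>{-1, 0, 1}\<close> almost surely but not necessarily everywhere.
\<close>

lemma AE_X_sign: "AE \<omega> in M. \<forall>k\<ge>1. X k \<omega> \<in> {-1, 0, 1}"
proof -
  have "prob ({\<omega>\<in>space M. X 1 \<omega> = 1} \<union> {\<omega>\<in>space M. X 1 \<omega> = -1}) =
      prob {\<omega>\<in>space M. X 1 \<omega> = 1} + prob {\<omega>\<in>space M. X 1 \<omega> = -1}"
    by (rule finite_measure_Union) auto
  then have "AE \<omega> in M. \<omega> \<in> {\<omega>\<in>space M. X 1 \<omega> = 1} \<union> {\<omega>\<in>space M. X 1 \<omega> = -1}"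
    using X_init by (intro AE_prob_1) simp
  moreover have "AE \<omega> in M. \<forall>n\<in>{1..}. C n \<omega> \<in> {-1, 0, 1}"
  proof (subst AE_ball_countable)
    show "\<forall>n\<in>{1..}. AE \<omega> in M. C n \<omega> \<in> {-1, 0, 1}"
    proof
      fix n :: nat assume "n \<in> {1..}"
      then show "AE \<omega> in M. C n \<omega> \<in> {-1, 0, 1}"
        using driver_measurable[OF walk_sources(3), of n] C_distr[of n] pqr
        by (intro AE_signs) (simp_all add: driver_def)
    qed
  qed auto
  ultimately show ?thesis
  proof eventually_elim
    case (elim \<omega>)
    note 1 = elim(1) and C = elim(2)
    have "1 \<le> k \<Longrightarrow> X k \<omega> \<in> {-1, 0, 1}" for k
    proof (induction k rule: less_induct)
      case (less k)
      show ?case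
      proof (cases "k = 1")
        case False
        with less.prems obtain n where k: "k = Suc n" and n: "1 \<le> n"
          by (cases k) auto
        have "U n \<omega> \<in> {1..n}" "X k \<omega> = C n \<omega> * X (U n \<omega>) \<omega>"
          using U_range X_step n k 1 by auto
        moreover have "C n \<omega> \<in> {-1, 0, 1}" using C n by auto
        moreover have "X (U n \<omega>) \<omega> \<in> {-1, 0, 1}"
          using less.IH[of "U n \<omega>"] \<open>U n \<omega> \<in> {1..n}\<close> k by auto
        ultimately show ?thesis by auto
      qed (use 1 in auto)
    qed
    then show ?case by blast
  qed
qed

section \<open>Fluctuation of a row around its conditional mean\<close>

definition move_density :: "nat \<Rightarrow> 'a \<Rightarrow> real" where
  "move_density n \<omega> = (\<Sum>i=1..m n. (X i \<omega>)\<^sup>2) / real (m n)"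

text \<open>
  The centred indicator of the event that position \<open>k\<close> of row \<open>n\<close> recalls time \<open>i\<close> and does not stop.
\<close>

definition recall_noise :: "nat \<Rightarrow> nat \<Rightarrow> nat \<Rightarrow> 'a \<Rightarrow> real" where
  "recall_noise n k i \<omega> = (D n k \<omega>)\<^sup>2 * of_bool (V n k \<omega> = i) - (1 - r) / real (m n)"

text \<open>
  The move indicator of position \<open>k\<close> minus its conditional probability given the walk.
\<close>

definition innovation :: "nat \<Rightarrow> nat \<Rightarrow> 'a \<Rightarrow> real" where
  "innovation n k \<omega> = (D n k \<omega>)\<^sup>2 * (X (V n k \<omega>) \<omega>)\<^sup>2 - (1 - r) * move_density n \<omega>"

context
  fixes n k :: nat
  assumes n: "1 \<le> n" and k: "m n < k" "k \<le> n"
begin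

lemma D_measurable_sigma_of: "Row_Choice n k \<in> J \<Longrightarrow> D n k \<in> borel_measurable (sigma_of J)"
  using driver_measurable_sigma_of[of "Row_Choice n k" J] by (simp add: driver_def)

lemma V_measurable_sigma_of:
  assumes "Row_Mem n k \<in> J"
  shows "(\<lambda>\<omega>. of_bool (V n k \<omega> = i) :: real) \<in> borel_measurable (sigma_of J)"
proof -
  have [measurable]: "(\<lambda>\<omega>. real (V n k \<omega>)) \<in> borel_measurable (sigma_of J)"
    using driver_measurable_sigma_of[OF assms] by (simp add: driver_def)
  have "(\<lambda>\<omega>. of_bool (real (V n k \<omega>) = real i) :: real) \<in> borel_measurable (sigma_of J)"
    by measurable
  then show ?thesis by simp
qed

lemma D_measurable [measurable]: "D n k \<in> borel_measurable M"
  using driver_measurable[OF row_sources(2)[OF n k]] by (simp add: driver_def)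

lemma V_measurable [measurable]: "(\<lambda>\<omega>. of_bool (V n k \<omega> = i) :: real) \<in> borel_measurable M"
  using measurable_sigma_of_into[OF _ V_measurable_sigma_of, of "{Row_Mem n k}"] row_sources[OF n k]
  by simp

lemma AE_D_sign: "AE \<omega> in M. D n k \<omega> \<in> {-1, 0, 1}"
  using D_distr[OF n k] pqr by (intro AE_signs) simp_all

lemma expectation_D_sq: "expectation (\<lambda>\<omega>. (D n k \<omega>)\<^sup>2) = 1 - r"
proof -
  have "expectation (\<lambda>\<omega>. (D n k \<omega>)\<^sup>2) =
      expectation (\<lambda>\<omega>. indicator {\<omega>\<in>space M. D n k \<omega> = 1} \<omega> + indicator {\<omega>\<in>space M. D n k \<omega> = -1} \<omega>)"
  proof (rule integral_cong_AE)
    show "AE \<omega> in M. (D n k \<omega>)\<^sup>2 =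
      indicator {\<omega>\<in>space M. D n k \<omega> = 1} \<omega> + indicator {\<omega>\<in>space M. D n k \<omega> = -1} \<omega>"
      using AE_D_sign AE_space by eventually_elim (auto simp: indicator_def)
  qed measurable
  also have "\<dots> = prob {\<omega>\<in>space M. D n k \<omega> = 1} + prob {\<omega>\<in>space M. D n k \<omega> = -1}"
  proof -
    have E: "{\<omega>\<in>space M. D n k \<omega> = x} \<in> events" for x by measurable
    have "integrable M (indicat_real {\<omega>\<in>space M. D n k \<omega> = x})" for x
      by (rule integrable_real_indicator[OF E]) (simp add: emeasure_eq_measure)
    then show ?thesis
      by (simp only: Bochner_Integration.integral_add Bochner_Integration.integral_indicator
          Int_absorb2[OF sets.sets_into_space[OF E]])
  qed
  also have "\<dots> = p + q"
    using D_distr[OF n k] by simp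
  finally show ?thesis using pqr by simp
qed

lemma expectation_recall_noise:
  assumes i: "i \<in> {1..m n}"
  shows "expectation (recall_noise n k i) = 0"
proof -
  have VM: "{\<omega>\<in>space M. V n k \<omega> = i} \<in> events"
  proof -
    have "{\<omega>\<in>space M. (of_bool (V n k \<omega> = i) :: real) = 1} \<in> events" by measurable
    then show ?thesis by simp
  qed
  have "expectation (\<lambda>\<omega>. of_bool (V n k \<omega> = i)) = expectation (\<lambda>\<omega>. indicator {\<omega>\<in>space M. V n k \<omega> = i} \<omega>)"
    by (intro Bochner_Integration.integral_cong) (auto simp: indicator_def)
  also have "\<dots> = prob {\<omega>\<in>space M. V n k \<omega> = i}"
    by (simp only: Bochner_Integration.integral_indicator Int_absorb2[OF sets.sets_into_space[OF VM]])
  also have "\<dots> = 1 / real (m n)"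
    by (rule V_unif[OF n k i])
  finally have V: "expectation (\<lambda>\<omega>. of_bool (V n k \<omega> = i)) = 1 / real (m n)" .
  have iD: "integrable M (\<lambda>\<omega>. (D n k \<omega>)\<^sup>2)"
    by (rule integrable_const_bound[where B=1]) (use AE_D_sign in auto)
  have iV: "integrable M (\<lambda>\<omega>. of_bool (V n k \<omega> = i) :: real)"
    by (rule integrable_const_bound[where B=1]) auto
  have ind: "indep_var borel (\<lambda>\<omega>. (D n k \<omega>)\<^sup>2) borel (\<lambda>\<omega>. of_bool (V n k \<omega> = i) :: real)"
    by (rule indep_sigma_of[of "{Row_Choice n k}" "{Row_Mem n k}"])
       (use row_sources[OF n k] in \<open>auto intro!: borel_measurable_power D_measurable_sigma_of V_measurable_sigma_of\<close>)
  have "expectation (\<lambda>\<omega>. (D n k \<omega>)\<^sup>2 * of_bool (V n k \<omega> = i)) = (1 - r) * (1 / real (m n))"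
    using indep_var_lebesgue_integral[OF ind iD iV] expectation_D_sq V by simp
  with indep_var_integrable[OF ind iD iV] show ?thesis
    unfolding recall_noise_def by (subst Bochner_Integration.integral_diff) (auto simp: prob_space)
qed

lemma expectation_mult_recall_noise:
  assumes G: "G \<in> borel_measurable (sigma_of (sources m - {Row_Mem n k, Row_Choice n k}))"
    and int: "integrable M G" and i: "i \<in> {1..m n}"
  shows "integrable M (\<lambda>\<omega>. G \<omega> * recall_noise n k i \<omega>)"
    and "expectation (\<lambda>\<omega>. G \<omega> * recall_noise n k i \<omega>) = 0"
proof -
  let ?R = "{Row_Mem n k, Row_Choice n k}"
  have meas: "recall_noise n k i \<in> borel_measurable (sigma_of ?R)"
    unfolding recall_noise_def[abs_def]
    by (intro borel_measurable_diff borel_measurable_times borel_measurable_power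
        D_measurable_sigma_of V_measurable_sigma_of borel_measurable_const) auto
  have R: "?R \<subseteq> sources m" using row_sources[OF n k] by auto
  have ind: "indep_var borel G borel (recall_noise n k i)"
    by (rule indep_sigma_of[OF _ _ R G meas]) auto
  have iN: "integrable M (recall_noise n k i)"
  proof (rule integrable_const_bound[where B="1 + \<bar>(1 - r) / real (m n)\<bar>"])
    show "AE \<omega> in M. norm (recall_noise n k i \<omega>) \<le> 1 + \<bar>(1 - r) / real (m n)\<bar>"
      using AE_D_sign
    proof eventually_elim
      case (elim \<omega>)
      then have "(D n k \<omega>)\<^sup>2 * of_bool (V n k \<omega> = i) \<in> {0, 1::real}" by auto
      then show ?case unfolding recall_noise_def real_norm_def by (auto simp del: abs_divide)
    qed
  qed (rule measurable_sigma_of_into[OF R meas])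
  show "integrable M (\<lambda>\<omega>. G \<omega> * recall_noise n k i \<omega>)"
    by (rule indep_var_integrable[OF ind int iN])
  show "expectation (\<lambda>\<omega>. G \<omega> * recall_noise n k i \<omega>) = 0"
    using indep_var_lebesgue_integral[OF ind int iN] expectation_recall_noise[OF i] by simp
qed

lemma innovation_eq_sum_noise:
  assumes "\<omega> \<in> space M"
  shows "innovation n k \<omega> = (\<Sum>i=1..m n. (X i \<omega>)\<^sup>2 * recall_noise n k i \<omega>)"
proof -
  have "(\<Sum>i=1..m n. (X i \<omega>)\<^sup>2 * recall_noise n k i \<omega>) =
      (\<Sum>i=1..m n. (D n k \<omega>)\<^sup>2 * (of_bool (V n k \<omega> = i) * (X i \<omega>)\<^sup>2)) -
      (\<Sum>i=1..m n. (1 - r) / real (m n) * (X i \<omega>)\<^sup>2)"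
    by (simp add: recall_noise_def algebra_simps sum_subtractf)
  also have "(\<Sum>i=1..m n. (D n k \<omega>)\<^sup>2 * (of_bool (V n k \<omega> = i) * (X i \<omega>)\<^sup>2)) =
      (D n k \<omega>)\<^sup>2 * (\<Sum>i=1..m n. of_bool (V n k \<omega> = i) * (X i \<omega>)\<^sup>2)"
    by (rule sum_distrib_left[symmetric])
  also have "(\<Sum>i=1..m n. of_bool (V n k \<omega> = i) * (X i \<omega>)\<^sup>2) = (X (V n k \<omega>) \<omega>)\<^sup>2"
    using V_range[OF n k assms] by (simp only: sum_of_bool_eq_mult finite_atLeastAtMost)
  finally show ?thesis
    by (simp add: innovation_def move_density_def sum_distrib_left sum_divide_distrib)
qed

lemma innovation_measurable_sigma_of:
  assumes J: "{Init} \<union> {Mem n | n. 1 \<le> n} \<union> {Choice n | n. 1 \<le> n} \<subseteq> J"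
    "Row_Mem n k \<in> J" "Row_Choice n k \<in> J"
  shows "innovation n k \<in> borel_measurable (sigma_of J)"
proof -
  have "(\<lambda>\<omega>. \<Sum>i=1..m n. (X i \<omega>)\<^sup>2 * recall_noise n k i \<omega>) \<in> borel_measurable (sigma_of J)"
    unfolding recall_noise_def using J
    by (intro borel_measurable_sum borel_measurable_times borel_measurable_power borel_measurable_diff
        X_measurable_sigma_of D_measurable_sigma_of V_measurable_sigma_of borel_measurable_const) auto
  also have "?this \<longleftrightarrow> ?thesis"
    by (rule measurable_cong) (simp add: innovation_eq_sum_noise)
  finally show ?thesis .
qed

lemma innovation_measurable [measurable]: "innovation n k \<in> borel_measurable M"
  by (rule measurable_sigma_of_into[OF order_refl innovation_measurable_sigma_of])
     (use row_sources[OF n k] in \<open>auto simp: sources_def\<close>)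

text \<open>
  By \<open>innovation_eq_sum_noise\<close> the product is a sum of terms \<open>G (X i)\<^sup>2\<close> times recall noise. The walk does
  not use the sources of position \<open>k\<close>, so the two factors are independent and the noise has mean
  zero. Taking for \<open>G\<close> the constant 1 or another innovation of the row gives mean zero and
  orthogonality.
\<close>

lemma expectation_mult_innovation:
  assumes G: "G \<in> borel_measurable (sigma_of (sources m - {Row_Mem n k, Row_Choice n k}))"
    and bounded: "AE \<omega> in M. \<bar>G \<omega>\<bar> \<le> 1"
  shows "expectation (\<lambda>\<omega>. G \<omega> * innovation n k \<omega>) = 0"
proof -
  let ?J = "sources m - {Row_Mem n k, Row_Choice n k}"
  have GX: "(\<lambda>\<omega>. G \<omega> * (X i \<omega>)\<^sup>2) \<in> borel_measurable (sigma_of ?J)" if "i \<in> {1..m n}" for i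
    using that by (intro borel_measurable_times G borel_measurable_power X_measurable_sigma_of)
      (auto simp: sources_def)
  have int: "integrable M (\<lambda>\<omega>. G \<omega> * (X i \<omega>)\<^sup>2)" if i: "i \<in> {1..m n}" for i
  proof (rule integrable_const_bound[where B=1])
    show "AE \<omega> in M. norm (G \<omega> * (X i \<omega>)\<^sup>2) \<le> 1"
      using AE_X_sign bounded
    proof eventually_elim
      case (elim \<omega>)
      then have "X i \<omega> \<in> {-1, 0, 1}" using i by auto
      then show ?case using elim by auto
    qed
    show "(\<lambda>\<omega>. G \<omega> * (X i \<omega>)\<^sup>2) \<in> borel_measurable M"
      using measurable_sigma_of_into[OF _ GX[OF i]] by blast
  qed
  have "expectation (\<lambda>\<omega>. G \<omega> * innovation n k \<omega>) =
      expectation (\<lambda>\<omega>. \<Sum>i=1..m n. G \<omega> * (X i \<omega>)\<^sup>2 * recall_noise n k i \<omega>)"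
    by (intro Bochner_Integration.integral_cong)
      (simp_all add: innovation_eq_sum_noise sum_distrib_left mult.assoc)
  also have "\<dots> = (\<Sum>i=1..m n. expectation (\<lambda>\<omega>. G \<omega> * (X i \<omega>)\<^sup>2 * recall_noise n k i \<omega>))"
    using expectation_mult_recall_noise(1)[OF GX int]
    by (intro Bochner_Integration.integral_sum) auto
  also have "\<dots> = 0"
    using expectation_mult_recall_noise(2)[OF GX int] by (intro sum.neutral) auto
  finally show ?thesis .
qed

end

lemma AE_density:
  assumes n: "1 \<le> n"
  shows "AE \<omega> in M. 0 \<le> move_density n \<omega> \<and> move_density n \<omega> \<le> 1"
  using AE_X_sign
proof eventually_elim
  case (elim \<omega>)
  have "(X i \<omega>)\<^sup>2 \<le> 1" if "i \<in> {1..m n}" for i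
  proof -
    have "X i \<omega> \<in> {-1, 0, 1}" using elim that by auto
    then show ?thesis by auto
  qed
  then have "(\<Sum>i=1..m n. (X i \<omega>)\<^sup>2) \<le> real (card {1..m n}) * 1"
    by (rule sum_bounded_above)
  then show ?case using m[OF n]
    by (auto simp: move_density_def divide_le_eq sum_nonneg)
qed

lemma move_density_measurable [measurable]: "move_density n \<in> borel_measurable M"
  unfolding move_density_def[abs_def] by measurable

text \<open>
  With \<open>z \<in> {0, 1}\<close> the move indicator and \<open>w \<in> [0, 1]\<close> its conditional mean,
  \<open>(z - w)\<^sup>2 \<le> z\<^sup>2 + w\<^sup>2 \<le> z + w\<close>. The right-hand side is written as \<open>(z - w) + 2 w\<close> because \<open>z - w\<close> is
  the innovation, whose mean vanishes.
\<close>

lemma innovation_bounds: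
  assumes "1 \<le> n" "m n < k" "k \<le> n"
  shows "AE \<omega> in M. \<bar>innovation n k \<omega>\<bar> \<le> 1 \<and>
    (innovation n k \<omega>)\<^sup>2 \<le> innovation n k \<omega> + 2 * (1 - r) * move_density n \<omega>"
  using AE_X_sign AE_density[OF assms(1)] AE_D_sign[OF assms] AE_space
proof eventually_elim
  case (elim \<omega>)
  define z w where "z = (D n k \<omega>)\<^sup>2 * (X (V n k \<omega>) \<omega>)\<^sup>2" and "w = (1 - r) * move_density n \<omega>"
  have "X (V n k \<omega>) \<omega> \<in> {-1, 0, 1}"
    using elim(1) V_range[OF assms elim(4)] by auto
  then have z: "z \<in> {0, 1}" using elim(3) by (auto simp: z_def)
  have w: "0 \<le> w" "w \<le> 1"
    using elim(2) r mult_mono[of "1 - r" 1 "move_density n \<omega>" 1] by (auto simp: w_def)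
  have "w * w \<le> w" using w mult_left_le by blast
  then have "(z - w)\<^sup>2 \<le> (z - w) + 2 * w" "\<bar>z - w\<bar> \<le> 1"
    using z w by (auto simp: power2_eq_square algebra_simps)
  then show ?case by (simp add: innovation_def z_def w_def algebra_simps)
qed

text \<open>
  By orthogonality the second moment of the sum grows linearly in the number of terms; keeping the
  factor \<open>E W\<close>, of order \<open>m powr (\<beta> - 1)\<close> in the application, is what makes the bound small enough.
\<close>

lemma expectation_sq_sum_innovations_le:
  assumes n: "1 \<le> n"
  shows "integrable M (\<lambda>\<omega>. (\<Sum>k\<in>{m n<..n}. innovation n k \<omega>)\<^sup>2)"
    and "expectation (\<lambda>\<omega>. (\<Sum>k\<in>{m n<..n}. innovation n k \<omega>)\<^sup>2) \<le>
      2 * real n * expectation (move_density n)"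
proof -
  let ?K = "{m n<..n}" and ?E = "\<lambda>k l. expectation (\<lambda>\<omega>. innovation n k \<omega> * innovation n l \<omega>)"
  have meas: "innovation n k \<in> borel_measurable M" if "k \<in> ?K" for k
    using that innovation_measurable[OF n] by auto
  have bd: "AE \<omega> in M. \<bar>innovation n k \<omega>\<bar> \<le> 1" if "k \<in> ?K" for k
    using innovation_bounds[OF n, of k] that by auto
  have prod_int: "integrable M (\<lambda>\<omega>. innovation n k \<omega> * innovation n l \<omega>)" if "k \<in> ?K" "l \<in> ?K" for k l
  proof (rule integrable_const_bound[where B=1])
    show "AE \<omega> in M. norm (innovation n k \<omega> * innovation n l \<omega>) \<le> 1"
      using bd[OF that(1)] bd[OF that(2)] by eventually_elim (simp add: abs_mult mult_le_one)
  qed (use meas that in simp)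
  have sq: "(\<Sum>k\<in>?K. innovation n k \<omega>)\<^sup>2 =
      (\<Sum>k\<in>?K. \<Sum>l\<in>?K. innovation n k \<omega> * innovation n l \<omega>)" for \<omega>
    by (simp add: power2_eq_square sum_product)
  show "integrable M (\<lambda>\<omega>. (\<Sum>k\<in>?K. innovation n k \<omega>)\<^sup>2)"
    unfolding sq using prod_int by (intro Bochner_Integration.integrable_sum) auto
  have off_diagonal: "?E k l = 0" if "k \<in> ?K" "l \<in> ?K" "k \<noteq> l" for k l
    using that n bd
    by (intro expectation_mult_innovation innovation_measurable_sigma_of) (auto simp: sources_def)
  have dens_int: "integrable M (move_density n)"
    by (rule integrable_const_bound[where B=1]) (use AE_density[OF n] in auto)
  have diagonal: "?E k k \<le> 2 * expectation (move_density n)" if k: "k \<in> ?K" for k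
  proof -
    have int: "integrable M (innovation n k)"
      by (rule integrable_const_bound[where B=1]) (use bd[OF k] meas[OF k] in auto)
    have mean: "expectation (innovation n k) = 0"
      using expectation_mult_innovation[OF n, of k "\<lambda>_. 1"] k by simp
    have "?E k k \<le> expectation (\<lambda>\<omega>. innovation n k \<omega> + 2 * (1 - r) * move_density n \<omega>)"
      using innovation_bounds[OF n, of k] k prod_int[OF k k] int dens_int
      by (intro integral_mono_AE) (auto simp: power2_eq_square)
    also have "\<dots> = 2 * (1 - r) * expectation (move_density n)"
      using int dens_int mean by simp
    also have "\<dots> \<le> 2 * expectation (move_density n)"
      using r integral_nonneg_AE[of "move_density n" M] AE_density[OF n]
      by (auto intro!: mult_right_mono)
    finally show ?thesis .
  qed
  have "expectation (\<lambda>\<omega>. (\<Sum>k\<in>?K. innovation n k \<omega>)\<^sup>2) = (\<Sum>k\<in>?K. \<Sum>l\<in>?K. ?E k l)"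
    unfolding sq
    by (subst Bochner_Integration.integral_sum;
        (intro sum.cong refl Bochner_Integration.integral_sum Bochner_Integration.integrable_sum prod_int))
  also have "\<dots> = (\<Sum>k\<in>?K. ?E k k)"
  proof (rule sum.cong[OF refl])
    fix k assume k: "k \<in> ?K"
    have "(\<Sum>l\<in>?K. ?E k l) = (\<Sum>l\<in>?K. if l = k then ?E k k else 0)"
      using off_diagonal k by (intro sum.cong) auto
    then show "(\<Sum>l\<in>?K. ?E k l) = ?E k k" using k by simp
  qed
  also have "\<dots> \<le> real (card ?K) * (2 * expectation (move_density n))"
    by (rule sum_bounded_above) (rule diagonal)
  also have "\<dots> \<le> real n * (2 * expectation (move_density n))"
    using integral_nonneg_AE[of "move_density n" M] AE_density[OF n]
    by (intro mult_right_mono) auto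
  finally show "expectation (\<lambda>\<omega>. (\<Sum>k\<in>?K. innovation n k \<omega>)\<^sup>2) \<le> 2 * real n * expectation (move_density n)"
    by simp
qed

section \<open>Decomposition of a row and the limit\<close>

lemma AE_moves_eq: "AE \<omega> in M. \<forall>N. moves X N \<omega> = (\<Sum>i=1..N. (X i \<omega>)\<^sup>2)"
  using AE_X_sign
proof eventually_elim
  case (elim \<omega>)
  have "of_bool (X i \<omega> \<noteq> 0) = (X i \<omega>)\<^sup>2" if "1 \<le> i" for i
    using elim that by (auto simp: of_bool_def dest!: spec[of _ i])
  then show ?case by (simp add: moves_def)
qed

lemma moves_measurable: "moves X N \<in> borel_measurable M"
proof -
  have "(\<lambda>\<omega>. of_bool (X k \<omega> \<noteq> 0) :: real) \<in> borel_measurable M" if "1 \<le> k" for k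
    using X_measurable[OF that] by measurable
  then show ?thesis unfolding moves_def[abs_def] by (intro borel_measurable_sum) auto
qed

text \<open>
  The first summand is the conditional mean \<open>\<Sigma>\<^sub>m + (n - m) \<beta> \<Sigma>\<^sub>m / m\<close> of the row, a multiple of
  \<open>\<Sigma>\<^sub>m\<close> with a deterministic coefficient.
\<close>

lemma AE_row_moves_eq:
  assumes n: "1 \<le> n"
  shows "AE \<omega> in M. row_moves m X V D n \<omega> =
    (1 + (1 - r) * (real n / real (m n) - 1)) * moves X (m n) \<omega> + (\<Sum>k\<in>{m n<..n}. innovation n k \<omega>)"
  using AE_moves_eq
proof eventually_elim
  case (elim \<omega>)
  have mn: "1 \<le> m n" "m n \<le> n" using m[OF n] by auto
  have split: "{1..n} = {1..m n} \<union> {m n<..n}" using mn by auto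
  have "row_moves m X V D n \<omega> = (\<Sum>k=1..m n. (row_step m X V D n k \<omega>)\<^sup>2) +
      (\<Sum>k\<in>{m n<..n}. (row_step m X V D n k \<omega>)\<^sup>2)"
    unfolding row_moves_def split by (rule sum.union_disjoint) auto
  also have "(\<Sum>k=1..m n. (row_step m X V D n k \<omega>)\<^sup>2) = moves X (m n) \<omega>"
    by (simp add: elim row_step_def)
  also have "(\<Sum>k\<in>{m n<..n}. (row_step m X V D n k \<omega>)\<^sup>2) =
      (\<Sum>k\<in>{m n<..n}. innovation n k \<omega> + (1 - r) * move_density n \<omega>)"
    by (intro sum.cong) (auto simp: row_step_def innovation_def power_mult_distrib)
  also have "\<dots> = (\<Sum>k\<in>{m n<..n}. innovation n k \<omega>) + real (n - m n) * ((1 - r) * move_density n \<omega>)"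
    by (simp add: sum.distrib)
  also have "move_density n \<omega> = moves X (m n) \<omega> / real (m n)"
    by (simp add: elim move_density_def)
  finally show ?case
    using mn by (simp add: of_nat_diff field_simps)
qed

lemma row_moves_measurable: "row_moves m X V D n \<in> borel_measurable M"
  unfolding row_moves_def[abs_def]
proof (rule borel_measurable_sum)
  fix k assume k: "k \<in> {1..n}"
  have "(\<lambda>\<omega>. if k \<le> m n then (X k \<omega>)\<^sup>2 else innovation n k \<omega> + (1 - r) * move_density n \<omega>)
      \<in> borel_measurable M"
  proof (cases "k \<le> m n")
    case False
    then have [measurable]: "innovation n k \<in> borel_measurable M"
      using k by (intro innovation_measurable) auto
    show ?thesis using False by simp
  qed (use k in simp)
  also have "(\<lambda>\<omega>. if k \<le> m n then (X k \<omega>)\<^sup>2 else innovation n k \<omega> + (1 - r) * move_density n \<omega>) =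
      (\<lambda>\<omega>. (row_step m X V D n k \<omega>)\<^sup>2)"
    by (auto simp: row_step_def innovation_def power_mult_distrib)
  finally show "(\<lambda>\<omega>. (row_step m X V D n k \<omega>)\<^sup>2) \<in> borel_measurable M" .
qed

lemma row_moves_sq_integrable: "integrable M (\<lambda>\<omega>. (row_moves m X V D n \<omega>)\<^sup>2)"
proof (cases "1 \<le> n")
  case n: True
  let ?c = "1 + (1 - r) * (real n / real (m n) - 1)"
  have int_moves: "integrable M (\<lambda>\<omega>. (?c * moves X (m n) \<omega>)\<^sup>2)"
  proof (rule integrable_const_bound[where B="(?c * real (m n))\<^sup>2"])
    have "\<bar>moves X (m n) \<omega>\<bar> \<le> real (m n)" for \<omega>
      using sum_bounded_above[of "{1..m n}" "\<lambda>i. of_bool (X i \<omega> \<noteq> 0)" "1::real"]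
      by (simp add: moves_def sum_nonneg)
    then show "AE \<omega> in M. norm ((?c * moves X (m n) \<omega>)\<^sup>2) \<le> (?c * real (m n))\<^sup>2"
      by (auto simp: power_mult_distrib intro!: mult_left_mono AE_I2 simp flip: abs_le_square_iff)
  qed (use moves_measurable in measurable)
  have "(\<lambda>\<omega>. \<Sum>k\<in>{m n<..n}. innovation n k \<omega>) \<in> borel_measurable M"
    using innovation_measurable[OF n] by (intro borel_measurable_sum) auto
  from integrable_sq_add(1)[OF _ this int_moves expectation_sq_sum_innovations_le(1)[OF n]]
  have "integrable M (\<lambda>\<omega>. (?c * moves X (m n) \<omega> + (\<Sum>k\<in>{m n<..n}. innovation n k \<omega>))\<^sup>2)"
    using moves_measurable by simp
  then show ?thesis
    by (rule integrable_cong_AE_imp) (use row_moves_measurable AE_row_moves_eq[OF n] in auto)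
qed (simp add: row_moves_def)

lemma expectation_density:
  assumes n: "1 \<le> n"
  shows "expectation (move_density n) =
    expectation (\<lambda>\<omega>. moves X (m n) \<omega> / real (m n) powr \<beta>) * real (m n) powr \<beta> / real (m n)"
proof -
  have "expectation (move_density n) =
    expectation (\<lambda>\<omega>. moves X (m n) \<omega> / real (m n) powr \<beta> * (real (m n) powr \<beta> / real (m n)))"
  proof (rule integral_cong_AE)
    show "AE \<omega> in M. move_density n \<omega> =
        moves X (m n) \<omega> / real (m n) powr \<beta> * (real (m n) powr \<beta> / real (m n))"
      using AE_moves_eq by eventually_elim (use m[OF n] in \<open>simp add: move_density_def\<close>)
  qed (use moves_measurable in measurable)
  then show ?thesis by simp
qed

end

theorem theorem5p3:
  fixes M :: "'a measure"
    and s p q r \<alpha> \<beta> \<gamma> :: real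
    and m :: "nat \<Rightarrow> nat"
    and X :: "nat \<Rightarrow> 'a \<Rightarrow> real"
    and U :: "nat \<Rightarrow> 'a \<Rightarrow> nat"
    and C :: "nat \<Rightarrow> 'a \<Rightarrow> real"
    and V :: "nat \<Rightarrow> nat \<Rightarrow> 'a \<Rightarrow> nat"
    and D :: "nat \<Rightarrow> nat \<Rightarrow> 'a \<Rightarrow> real"
    and \<Sigma> :: "'a \<Rightarrow> real"
  assumes "erw_stops_array M s p q r m X U C V D"
    and "\<alpha> = p - q" and "\<beta> = 1 - r"
    and "\<beta> \<in> {0<..<1}" and "\<alpha> \<in> {-\<beta>..\<beta>}"
    and "filterlim m at_top sequentially"
    and "(\<lambda>n. real (m n) / real n) \<longlonglongrightarrow> \<gamma>" and "\<gamma> \<in> {0..1}"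
    and "AE \<omega> in M. (\<lambda>n. moves X n \<omega> / real n powr \<beta>) \<longlonglongrightarrow> \<Sigma> \<omega>"
    and "tendsto_L2 M (\<lambda>n \<omega>. moves X n \<omega> / real n powr \<beta>) \<Sigma>"
  shows "tendsto_L2 M
    (\<lambda>n \<omega>. (real (m n) / real n) * row_moves m X V D n \<omega> / real (m n) powr \<beta>)
    (\<lambda>\<omega>. (\<gamma> + \<beta> * (1 - \<gamma>)) * \<Sigma> \<omega>)"
proof -
  interpret erw_stops_array M s p q r m X U C V D by fact
  define \<gamma>' where "\<gamma>' n = real (m n) / real n" for n
  define f where "f n \<omega> = moves X (m n) \<omega> / real (m n) powr \<beta>" for n \<omega>
  define F where "F n \<omega> = \<gamma>' n * row_moves m X V D n \<omega> / real (m n) powr \<beta>" for n \<omega>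
  have f: "tendsto_L2 M f \<Sigma>"
    using tendsto_L2_reindex[OF assms(10) assms(6)] by (simp add: f_def[abs_def])
  have "tendsto_L2 M (\<lambda>n \<omega>. (\<gamma>' n + \<beta> * (1 - \<gamma>' n)) * f n \<omega>) (\<lambda>\<omega>. (\<gamma> + \<beta> * (1 - \<gamma>)) * \<Sigma> \<omega>)"
    by (intro tendsto_L2_scale[OF f] tendsto_intros) (use assms(7) in \<open>simp_all add: \<gamma>'_def[abs_def]\<close>)
  then have "tendsto_L2 M F (\<lambda>\<omega>. (\<gamma> + \<beta> * (1 - \<gamma>)) * \<Sigma> \<omega>)"
  proof (rule tendsto_L2_perturb)
    show "F n \<in> borel_measurable M" for n
      using row_moves_measurable unfolding F_def[abs_def] by measurable
    show "integrable M (\<lambda>\<omega>. (F n \<omega>)\<^sup>2)" for n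
      using row_moves_sq_integrable[of n] by (simp add: F_def power_mult_distrib power_divide)
    obtain K where K: "\<And>n. expectation (f n) \<le> K"
      using tendsto_L2_expectation_bounded[OF f] by blast
    have bound: "(\<integral>\<omega>. (F n \<omega> - (\<gamma>' n + \<beta> * (1 - \<gamma>' n)) * f n \<omega>)\<^sup>2 \<partial>M) \<le>
        2 * \<bar>K\<bar> * real (m n) powr (-\<beta>)" if n: "1 \<le> n" for n
    proof -
      have mn: "1 \<le> m n" "m n \<le> n" using m[OF n] by auto
      define a where "a = \<gamma>' n / real (m n) powr \<beta>"
      let ?S = "\<lambda>\<omega>. \<Sum>k\<in>{m n<..n}. innovation n k \<omega>"
      have "AE \<omega> in M. F n \<omega> - (\<gamma>' n + \<beta> * (1 - \<gamma>' n)) * f n \<omega> = a * ?S \<omega>"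
        using AE_row_moves_eq[OF n]
      proof eventually_elim
        case (elim \<omega>)
        have "\<gamma>' n * (1 + \<beta> * (real n / real (m n) - 1)) = \<gamma>' n + \<beta> * (1 - \<gamma>' n)"
          using mn n by (simp add: \<gamma>'_def field_simps)
        then have "F n \<omega> = (\<gamma>' n + \<beta> * (1 - \<gamma>' n)) * f n \<omega> + a * ?S \<omega>"
          unfolding F_def f_def a_def elim assms(3)[symmetric]
          by (simp add: distrib_left add_divide_distrib mult.assoc[symmetric])
        then show ?case by simp
      qed
      then have "(\<integral>\<omega>. (F n \<omega> - (\<gamma>' n + \<beta> * (1 - \<gamma>' n)) * f n \<omega>)\<^sup>2 \<partial>M) = (\<integral>\<omega>. (a * ?S \<omega>)\<^sup>2 \<partial>M)"
        using row_moves_measurable moves_measurable innovation_measurable[OF n]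
        unfolding F_def f_def
        by (intro integral_cong_AE) (auto intro!: borel_measurable_power borel_measurable_diff
            borel_measurable_times borel_measurable_divide borel_measurable_sum)
      also have "\<dots> = a\<^sup>2 * expectation (\<lambda>\<omega>. (?S \<omega>)\<^sup>2)"
        by (simp add: power_mult_distrib)
      also have "\<dots> \<le> a\<^sup>2 * (2 * real n * expectation (move_density n))"
        by (intro mult_left_mono expectation_sq_sum_innovations_le(2)[OF n]) simp
      \<comment> \<open>\<open>(m/n)\<^sup>2 m powr (-2\<beta>) n m powr (\<beta> - 1) = (m/n) m powr (-\<beta>)\<close>\<close>
      also have "\<dots> = 2 * \<gamma>' n * real (m n) powr (-\<beta>) * expectation (f n)"
        unfolding expectation_density[OF n, of \<beta>] a_def \<gamma>'_def f_def[abs_def] using n mn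
        by (simp add: power2_eq_square powr_minus field_simps)
      also have "\<dots> \<le> 2 * 1 * real (m n) powr (-\<beta>) * \<bar>K\<bar>"
      proof -
        have "0 \<le> expectation (f n)"
          by (intro Bochner_Integration.integral_nonneg) (simp add: f_def moves_def sum_nonneg)
        then show ?thesis
          using K[of n] mn n by (intro mult_mono) (auto simp: \<gamma>'_def)
      qed
      finally show ?thesis by (simp add: mult_ac)
    qed
    have "(\<lambda>n. real (m n) powr (-\<beta>)) \<longlonglongrightarrow> 0"
      using assms(4) filterlim_compose[OF filterlim_real_sequentially assms(6)]
      by (intro tendsto_neg_powr) auto
    note lim = tendsto_mult_right_zero[OF this, of "2 * \<bar>K\<bar>"]
    show "(\<lambda>n. \<integral>\<omega>. (F n \<omega> - (\<gamma>' n + \<beta> * (1 - \<gamma>' n)) * f n \<omega>)\<^sup>2 \<partial>M) \<longlonglongrightarrow> 0"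
    proof (rule tendsto_sandwich[OF _ _ tendsto_const lim])
      show "\<forall>\<^sub>F n in sequentially.
          (\<integral>\<omega>. (F n \<omega> - (\<gamma>' n + \<beta> * (1 - \<gamma>' n)) * f n \<omega>)\<^sup>2 \<partial>M) \<le> 2 * \<bar>K\<bar> * real (m n) powr (-\<beta>)"
        by (rule eventually_sequentiallyI[of 1]) (rule bound)
    qed simp
  qed
  then show ?thesis
    by (simp add: F_def[abs_def] \<gamma>'_def)
qed

end
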